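(* Let $g_d$ denote the NAND tree function of depth $d$. There is a constant $c<1$ such that $\mathsf{D}^{\mathsf{prod}}(g_d)=O(\mathsf{RS}(g_d)^{c})$, i.e., $\mathsf{D}^{\mathsf{prod}}(g_d)=O(\mathsf{RS}(g_d)^{1-\Omega(1)})$.
   Context: The NAND tree function $g_d:\{0,1\}^{2^d}\to\{0,1\}$ is the Boolean formula given by a complete binary tree of depth $d$ whose $2^d$ leaves are labelled by distinct variables and whose internal nodes are binary NAND gates. A deterministic decision tree adaptively queries input bits; its cost is its depth. A randomized decision tree is a probability distribution over deterministic decision trees; its query complexity is the maximum depth in its support. For a distribution $\mu$, $\mathsf{D}^\mu_{1/3}(g)$ is the minimum depth of a deterministic decision tree $T$ with $\Pr_{x\sim\mu}[T(x)\neq g(x)]\le1/3$; $\mathsf{D}^{\mathsf{prod}}(g)$ is the maximum of $\mathsf{D}^\mu_{1/3}(g)$ over product distributions $\mu$ (distributions with independent coordinates). The sabotage complexity $\mathsf{RS}(g)$ is the minimum query complexity of a randomized decision tree $\mathcal{R}$ such that for every $x\in g^{-1}(0)$, $y\in g^{-1}(1)$, with probability at least $2/3$ a tree $T\sim\mathcal{R}$ run on $x$ queries some index $i$ with $x_i\neq y_i$. *)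

theory Defs
  imports "HOL-Probability.Probability" "HOL-Probability.Product_PMF" "HOL-Library.Landau_Symbols"
begin

text \<open>
  A point of the cube \<open>{0,1}\<^sup>n\<close> is a function on \<open>nat\<close> that is \<open>False\<close> at all indices \<open>i \<ge> n\<close>.
  A Boolean function on the cube is a function on \<open>nat \<Rightarrow> bool\<close> together with the arity \<open>n\<close>;
  only its values on \<open>cube n\<close> matter below.
\<close>

definition cube :: "nat \<Rightarrow> (nat \<Rightarrow> bool) set" where
  "cube n = {x. \<forall>i\<ge>n. \<not> x i}"

fun nand_tree :: "nat \<Rightarrow> (nat \<Rightarrow> bool) \<Rightarrow> bool" where
  "nand_tree 0 x = x 0"
| "nand_tree (Suc d) x = (\<not> (nand_tree d x \<and> nand_tree d (\<lambda>i. x (2 ^ d + i))))"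

text \<open>\<open>Query i T0 T1\<close> queries \<open>x i\<close> and continues with \<open>T0\<close> on answer 0 and with \<open>T1\<close> on answer 1.\<close>

datatype dtree = Leaf bool | Query nat dtree dtree

fun dt_indices :: "dtree \<Rightarrow> nat set" where
  "dt_indices (Leaf b) = {}"
| "dt_indices (Query i T0 T1) = insert i (dt_indices T0 \<union> dt_indices T1)"

definition dtrees :: "nat \<Rightarrow> dtree set" where
  "dtrees n = {T. dt_indices T \<subseteq> {..<n}}"

fun dt_depth :: "dtree \<Rightarrow> nat" where
  "dt_depth (Leaf b) = 0"
| "dt_depth (Query i T0 T1) = Suc (max (dt_depth T0) (dt_depth T1))"

fun dt_eval :: "dtree \<Rightarrow> (nat \<Rightarrow> bool) \<Rightarrow> bool" where
  "dt_eval (Leaf b) x = b"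
| "dt_eval (Query i T0 T1) x = (if x i then dt_eval T1 x else dt_eval T0 x)"

fun dt_queried :: "dtree \<Rightarrow> (nat \<Rightarrow> bool) \<Rightarrow> nat set" where
  "dt_queried (Leaf b) x = {}"
| "dt_queried (Query i T0 T1) x = insert i (if x i then dt_queried T1 x else dt_queried T0 x)"

definition product_distributions :: "nat \<Rightarrow> (nat \<Rightarrow> bool) pmf set" where
  "product_distributions n = {Pi_pmf {..<n} False q | q. True}"

definition dist_complexity :: "nat \<Rightarrow> ((nat \<Rightarrow> bool) \<Rightarrow> bool) \<Rightarrow> (nat \<Rightarrow> bool) pmf \<Rightarrow> nat" where
  "dist_complexity n g \<mu> =
     (LEAST k. \<exists>T\<in>dtrees n. dt_depth T = k \<and> measure_pmf.prob \<mu> {x. dt_eval T x \<noteq> g x} \<le> 1 / 3)"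

definition D_prod :: "nat \<Rightarrow> ((nat \<Rightarrow> bool) \<Rightarrow> bool) \<Rightarrow> nat" where
  "D_prod n g = Max (dist_complexity n g ` product_distributions n)"

text \<open>
  The query complexity of a randomized decision tree \<open>R\<close> is the maximal depth in its support, so
  it is at most \<open>k\<close> iff all trees in \<open>set_pmf R\<close> have depth at most \<open>k\<close>.
\<close>

definition RS :: "nat \<Rightarrow> ((nat \<Rightarrow> bool) \<Rightarrow> bool) \<Rightarrow> nat" where
  "RS n g =
     (LEAST k. \<exists>R :: dtree pmf. set_pmf R \<subseteq> dtrees n \<and> (\<forall>T\<in>set_pmf R. dt_depth T \<le> k) \<and>
        (\<forall>x\<in>cube n. \<forall>y\<in>cube n. \<not> g x \<longrightarrow> g y \<longrightarrow>
           measure_pmf.prob R {T. \<exists>i\<in>dt_queried T x. x i \<noteq> y i} \<ge> 2 / 3))"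

text \<open>The minima and the maximum above are attained.\<close>

fun full_dtree :: "((nat \<Rightarrow> bool) \<Rightarrow> bool) \<Rightarrow> nat \<Rightarrow> (nat \<Rightarrow> bool) \<Rightarrow> dtree" where
  "full_dtree g 0 a = Leaf (g a)"
| "full_dtree g (Suc m) a = Query m (full_dtree g m (a(m := False))) (full_dtree g m (a(m := True)))"

lemma full_dtree_indices: "dt_indices (full_dtree g m a) \<subseteq> {..<m}"
  by (induction m arbitrary: a) (force simp: subset_iff)+

lemma full_dtree_depth: "dt_depth (full_dtree g m a) = m"
  by (induction m arbitrary: a) auto

lemma full_dtree_queried: "dt_queried (full_dtree g m a) x = {..<m}"
  by (induction m arbitrary: a) (auto simp: lessThan_Suc)

lemma full_dtree_eval: "dt_eval (full_dtree g m a) x = g (\<lambda>i. if i < m then x i else a i)"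
proof (induction m arbitrary: a)
  case (Suc m)
  have "(\<lambda>i. if i < m then x i else (a(m := x m)) i) = (\<lambda>i. if i < Suc m then x i else a i)"
    by (auto simp: fun_eq_iff less_Suc_eq)
  moreover have "dt_eval (full_dtree g (Suc m) a) x = dt_eval (full_dtree g m (a(m := x m))) x"
    by (cases "x m") simp_all
  ultimately show ?case
    by (simp only: Suc.IH)
qed simp

lemma full_dtree_eval_cube:
  assumes "x \<in> cube n"
  shows "dt_eval (full_dtree g n (\<lambda>_. False)) x = g x"
proof -
  have "(\<lambda>i. if i < n then x i else False) = x"
    using assms by (auto simp: cube_def fun_eq_iff)
  then show ?thesis
    by (simp add: full_dtree_eval)
qed

lemma product_distributions_nonempty: "product_distributions n \<noteq> {}"
  by (auto simp: product_distributions_def)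

lemma set_pmf_product_distribution:
  assumes "\<mu> \<in> product_distributions n"
  shows "set_pmf \<mu> \<subseteq> cube n"
  using assms set_Pi_pmf_subset[of "{..<n}" False]
  by (fastforce simp: product_distributions_def cube_def)

lemma full_dtree_error:
  assumes "\<mu> \<in> product_distributions n"
  shows "measure_pmf.prob \<mu> {x. dt_eval (full_dtree g n (\<lambda>_. False)) x \<noteq> g x} = 0"
  using set_pmf_product_distribution[OF assms] full_dtree_eval_cube
  by (auto simp: measure_pmf_zero_iff)

lemma dist_complexity_attained:
  assumes "\<mu> \<in> product_distributions n"
  shows "\<exists>T\<in>dtrees n. dt_depth T = dist_complexity n g \<mu> \<and>
    measure_pmf.prob \<mu> {x. dt_eval T x \<noteq> g x} \<le> 1 / 3"
  unfolding dist_complexity_def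
  by (rule LeastI[of _ n], rule bexI[of _ "full_dtree g n (\<lambda>_. False)"])
     (use full_dtree_error[OF assms, of g] full_dtree_indices
       in \<open>auto simp: full_dtree_depth dtrees_def\<close>)

lemma dist_complexity_le:
  assumes "\<mu> \<in> product_distributions n"
  shows "dist_complexity n g \<mu> \<le> n"
  unfolding dist_complexity_def
  by (rule Least_le, rule bexI[of _ "full_dtree g n (\<lambda>_. False)"])
     (use full_dtree_error[OF assms, of g] full_dtree_indices
       in \<open>auto simp: full_dtree_depth dtrees_def\<close>)

lemma finite_dist_complexity: "finite (dist_complexity n g ` product_distributions n)"
  by (rule finite_subset[of _ "{..n}"]) (auto intro: dist_complexity_le)

lemma RS_attained:
  "\<exists>R. set_pmf R \<subseteq> dtrees n \<and> (\<forall>T\<in>set_pmf R. dt_depth T \<le> RS n g) \<and>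
     (\<forall>x\<in>cube n. \<forall>y\<in>cube n. \<not> g x \<longrightarrow> g y \<longrightarrow>
        measure_pmf.prob R {T. \<exists>i\<in>dt_queried T x. x i \<noteq> y i} \<ge> 2 / 3)"
  unfolding RS_def
proof (rule LeastI[of _ n], rule exI[of _ "return_pmf (full_dtree g n (\<lambda>_. False))"], intro conjI ballI impI)
  fix x y assume xy: "x \<in> cube n" "y \<in> cube n" "\<not> g x" "g y"
  have "\<exists>i<n. x i \<noteq> y i"
  proof (rule ccontr)
    assume "\<not> (\<exists>i<n. x i \<noteq> y i)"
    then have "x = y"
      using xy by (auto simp: cube_def fun_eq_iff) (metis not_le)+
    then show False using xy by simp
  qed
  then show "2 / 3 \<le> measure_pmf.prob (return_pmf (full_dtree g n (\<lambda>_. False)))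
      {T. \<exists>i\<in>dt_queried T x. x i \<noteq> y i}"
    by (auto simp: full_dtree_queried indicator_def)
qed (use full_dtree_indices in \<open>auto simp: full_dtree_depth dtrees_def\<close>)

end

theory Submission
  imports Defs
begin

text \<open>
  Lower bound on \<open>RS\<close> (after Saks and Wigderson): consider ternary inputs with a star at one leaf, on
  which the root value depends. A star node is given the children star and 1, a 1-node the children 0
  and 1, in random order, and a 0-node two children 1. Let reading a leaf cost \<open>k 0\<close>, \<open>k 1\<close> or \<open>k *\<close>
  according to its value. A tree that reads the leaves of one gate is simulated by a tree that reads
  only the value of the gate: with probability 1/2 it does so when the first child is read, and
  otherwise it answers 1 to the first read and reads the gate only when the other child is read. The
  simulation is faithful and not more expensive if reading the gate costs \<open>2 k 1\<close>, \<open>k 0 + k 1 / 2\<close>,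
  \<open>k * + k 1 / 2\<close>. Contracting the whole tree in this way, the costs grow at least like \<open>(5/3)^d\<close>
  (the true rate is \<open>(1 + sqrt 33) / 4\<close>). Giving stars at the leaves the cost \<open>1 - K\<close> with \<open>K\<close> the
  contracted cost of a star makes the star at the root free, so the expected number of queries of
  every tree is at least \<open>K\<close> times its probability of finding the star.

  Upper bound on \<open>D_prod\<close>: under a product distribution, evaluate first the child that is 1 with
  smaller probability, and the other one only if needed. If \<open>p\<close> is the probability that a node
  has value 1, the expected cost is at most \<open>\<gamma>^d (1 + \<kappa> (1 - p))\<close> whenever
  \<open>(\<gamma> + 1) (\<gamma> - 1)\<^sup>2 \<ge> 1\<close> and \<open>\<kappa> = (\<gamma> - 1) / 2\<close>; the golden ratio is the optimal \<open>\<gamma>\<close>, and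
  \<open>\<gamma> = 13/8 < 5/3\<close> suffices. Truncating at three times the expected cost leaves error at most 1/3.
\<close>

section \<open>Sabotage complexity\<close>

datatype sval = Zero | One | Star

fun sneg :: "sval \<Rightarrow> sval" where
  "sneg Zero = One"
| "sneg One = Zero"
| "sneg Star = Star"

text \<open>Charging stops at the first star, since finding it is the goal of the tree.\<close>

fun scost :: "(nat \<Rightarrow> sval \<Rightarrow> real) \<Rightarrow> dtree \<Rightarrow> (nat \<Rightarrow> sval) \<Rightarrow> real" where
  "scost c (Leaf b) w = 0"
| "scost c (Query i T0 T1) w =
     c i (w i) + (case w i of Zero \<Rightarrow> scost c T0 w | One \<Rightarrow> scost c T1 w | Star \<Rightarrow> 0)"

fun parent_cost :: "(sval \<Rightarrow> real) \<Rightarrow> sval \<Rightarrow> real" where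
  "parent_cost k Zero = 2 * k One"
| "parent_cost k One = k Zero + k One / 2"
| "parent_cost k Star = k Star + k One / 2"

fun dt_restrict :: "(nat \<rightharpoonup> bool) \<Rightarrow> dtree \<Rightarrow> dtree" where
  "dt_restrict \<rho> (Leaf b) = Leaf b"
| "dt_restrict \<rho> (Query i T0 T1) =
     (case \<rho> i of None \<Rightarrow> Query i (dt_restrict \<rho> T0) (dt_restrict \<rho> T1)
      | Some b \<Rightarrow> if b then dt_restrict \<rho> T1 else dt_restrict \<rho> T0)"

text \<open>
  The two halves of the simulation for a gate with leaves \<open>l\<close> and \<open>r\<close>; afterwards the index \<open>l\<close>
  stands for the gate itself. In \<open>dt_pending v l r\<close> the child \<open>l\<close> has been answered by 1 without
  reading the gate, and \<open>v\<close> is the index of the gate.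
\<close>

fun dt_early :: "nat \<Rightarrow> nat \<Rightarrow> dtree \<Rightarrow> dtree" where
  "dt_early l r (Leaf b) = Leaf b"
| "dt_early l r (Query i T0 T1) =
     (if i = l \<or> i = r
      then Query l (dt_restrict [l \<mapsto> True, r \<mapsto> True] T1)
        (dt_restrict (if i = l then [l \<mapsto> False, r \<mapsto> True] else [l \<mapsto> True, r \<mapsto> False]) T0)
      else Query i (dt_early l r T0) (dt_early l r T1))"

fun dt_pending :: "nat \<Rightarrow> nat \<Rightarrow> nat \<Rightarrow> dtree \<Rightarrow> dtree" where
  "dt_pending v l r (Leaf b) = Leaf b"
| "dt_pending v l r (Query i T0 T1) =
     (if i = l then dt_pending v l r T1
      else if i = r
      then Query v (dt_restrict [l \<mapsto> True, r \<mapsto> True] T1) (dt_restrict [l \<mapsto> True, r \<mapsto> False] T0)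
      else Query i (dt_pending v l r T0) (dt_pending v l r T1))"

fun dt_late :: "nat \<Rightarrow> nat \<Rightarrow> dtree \<Rightarrow> dtree" where
  "dt_late l r (Leaf b) = Leaf b"
| "dt_late l r (Query i T0 T1) =
     (if i = l then dt_pending l l r T1
      else if i = r then dt_pending l r l T1
      else Query i (dt_late l r T0) (dt_late l r T1))"

text \<open>\<open>Star\<close> is left out because the discounted cost \<open>1 - K\<close> of a
  leaf star may be negative.\<close>

definition nonneg_cost :: "(nat \<Rightarrow> sval \<Rightarrow> real) \<Rightarrow> bool" where
  "nonneg_cost c \<longleftrightarrow> (\<forall>i. 0 \<le> c i Zero \<and> 0 \<le> c i One)"

section \<open>Contraction of a single gate\<close>

lemma nonneg_costD:
  assumes "nonneg_cost c"
  shows "0 \<le> c i Zero" "0 \<le> c i One"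
  using assms by (auto simp: nonneg_cost_def)

text \<open>Restricting only deletes queries, and \<rho> never stands for a star, so every deleted
  cost is nonnegative.\<close>

lemma scost_restrict_le:
  assumes "nonneg_cost c"
    and "\<And>i. \<rho> i = None \<Longrightarrow> c' i = c i \<and> u i = w i"
    and "\<And>i b. \<rho> i = Some b \<Longrightarrow> w i = (if b then One else Zero)"
  shows "scost c' (dt_restrict \<rho> T) u \<le> scost c T w"
proof (induction T)
  case (Query i T0 T1)
  show ?case
  proof (cases "\<rho> i")
    case None
    then show ?thesis
      using assms(2)[OF None] Query by (auto split: sval.splits)
  next
    case (Some b)
    then show ?thesis
      using assms(3)[OF Some] Query nonneg_costD[OF assms(1), of i] by (cases b) auto
  qed
qed simp

context
  \<comment> \<open>The gate index \<open>v\<close> is kept apart from \<open>l\<close>, so that the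
    lemmas also apply with the children exchanged.\<close>
  fixes c c' :: "nat \<Rightarrow> sval \<Rightarrow> real" and l r v :: nat and k :: "sval \<Rightarrow> real"
  assumes lr: "l \<noteq> r"
    and nonneg: "nonneg_cost c"
    and k: "c l = k" "c r = k"
    and c'v: "c' v = parent_cost k"
    and c'_off: "\<forall>i. i \<noteq> l \<longrightarrow> i \<noteq> r \<longrightarrow> c' i = c i"
begin

lemma restrict_pair_le:
  "scost c' (dt_restrict [l \<mapsto> x, r \<mapsto> y] T) u
     \<le> scost c T (u(l := if x then One else Zero, r := if y then One else Zero))"
  using lr by (intro scost_restrict_le[OF nonneg]) (auto simp: c'_off split: if_splits)

lemma k_One_nonneg: "0 \<le> k One"
  using nonneg_costD(2)[OF nonneg, of l] k by simp

text \<open>On reading \<open>r\<close> the pending tree pays \<open>2 * k One\<close> where the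
  simulated tree pays \<open>k One\<close>. The restricted tree follows the same path and skips this
  charge, so the excess cancels in the sum.\<close>

lemma pending_Zero_le:
  assumes "u v = Zero"
  shows "scost c' (dt_restrict [l \<mapsto> True, r \<mapsto> True] T) u + scost c' (dt_pending v l r T) u
    \<le> 2 * scost c T (u(l := One, r := One))"
proof -
  define w where "w = u(l := One, r := One)"
  define \<rho> where "\<rho> = [l \<mapsto> True, r \<mapsto> True]"
  have w: "w l = One" "w r = One" "\<And>i. i \<noteq> l \<Longrightarrow> i \<noteq> r \<Longrightarrow> w i = u i"
    and \<rho>: "\<rho> l = Some True" "\<rho> r = Some True" "\<And>i. i \<noteq> l \<Longrightarrow> i \<noteq> r \<Longrightarrow> \<rho> i = None"
    using lr by (auto simp: w_def \<rho>_def)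
  have restr: "scost c' (dt_restrict \<rho> T) u \<le> scost c T w" for T
    using restrict_pair_le[of True True T u] by (simp only: w_def \<rho>_def if_True)
  have pend: "dt_pending v l r (Query i T0 T1) =
     (if i = l then dt_pending v l r T1
      else if i = r then Query v (dt_restrict \<rho> T1) (dt_restrict [l \<mapsto> True, r \<mapsto> False] T0)
      else Query i (dt_pending v l r T0) (dt_pending v l r T1))" for i T0 T1
    by (simp only: dt_pending.simps \<rho>_def)
  have "scost c' (dt_restrict \<rho> T) u + scost c' (dt_pending v l r T) u \<le> 2 * scost c T w"
  proof (induction T)
    case (Query i T0 T1)
    consider "i = l" | "i = r" | "i \<noteq> l" "i \<noteq> r" by blast
    then show ?case
    proof cases
      case 1
      then show ?thesis using Query w \<rho> k k_One_nonneg by simp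
    next
      case 2
      then show ?thesis using w \<rho> k c'v assms lr restr[of T1] by (simp add: pend del: dt_pending.simps(2))
    next
      case 3
      then show ?thesis using Query w(3) \<rho>(3) c'_off by (cases "u i") auto
    qed
  qed simp
  then show ?thesis by (simp only: w_def \<rho>_def)
qed

text \<open>The surplus \<open>k One / 2\<close> is paid at most once: after the gate is read,
  either both children are fixed or a star has ended the run.\<close>

lemma pending_le:
  assumes "u v \<noteq> Zero"
  shows "scost c' (dt_pending v l r T) u
    \<le> scost c T (u(l := One, r := sneg (u v))) + k One / 2"
proof -
  define w where "w = u(l := One, r := sneg (u v))"
  have w: "w l = One" "w r = sneg (u v)" "\<And>i. i \<noteq> l \<Longrightarrow> i \<noteq> r \<Longrightarrow> w i = u i"
    using lr by (auto simp: w_def)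
  define \<rho> where "\<rho> = [l \<mapsto> True, r \<mapsto> False]"
  have restr: "scost c' (dt_restrict \<rho> T) u \<le> scost c T w" if "u v = One" for T
    using restrict_pair_le[of True False T u] by (simp only: w_def \<rho>_def if_True if_False that sneg.simps)
  have pend: "dt_pending v l r (Query i T0 T1) =
     (if i = l then dt_pending v l r T1
      else if i = r then Query v (dt_restrict [l \<mapsto> True, r \<mapsto> True] T1) (dt_restrict \<rho> T0)
      else Query i (dt_pending v l r T0) (dt_pending v l r T1))" for i T0 T1
    by (simp only: dt_pending.simps \<rho>_def)
  have "scost c' (dt_pending v l r T) u \<le> scost c T w + k One / 2"
  proof (induction T)
    case (Leaf b)
    then show ?case using k_One_nonneg by simp
  next
    case (Query i T0 T1)
    consider "i = l" | "i = r" | "i \<noteq> l" "i \<noteq> r" by blast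
    then show ?case
    proof cases
      case 1
      then show ?thesis using Query w k k_One_nonneg by simp
    next
      case 2
      then show ?thesis using w k c'v assms lr restr[of T0] by (cases "u v") (simp_all add: pend del: dt_pending.simps(2))
    next
      case 3
      then show ?thesis using Query w(3) c'_off k_One_nonneg by (cases "u i") auto
    qed
  qed
  then show ?thesis by (simp only: w_def)
qed

end

text \<open>One child is 1, and NAND with 1 negates, so the other child is
  \<open>sneg (u l)\<close>; this covers all three gate values, and the average is over the order of
  the children.\<close>

definition gate_avg ::
  "nat \<Rightarrow> nat \<Rightarrow> ((nat \<Rightarrow> sval) \<Rightarrow> real) \<Rightarrow> (nat \<Rightarrow> sval) \<Rightarrow> real" where
  "gate_avg l r G u =
     (G (u(l := sneg (u l), r := One)) + G (u(l := One, r := sneg (u l)))) / 2"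

text \<open>At value 0 the early tree pays for both children at once and
  \<open>pending_Zero_le\<close> balances what follows. Otherwise each half has a surplus of at most
  \<open>c r One / 2\<close>, covered by the 1 that the late tree answers for free.\<close>

lemma early_late_le:
  assumes lr: "l \<noteq> r" and nonneg: "nonneg_cost c" and eq: "c l = c r"
  defines "c' \<equiv> c(l := parent_cost (c r))"
  shows "(scost c' (dt_early l r T) u + scost c' (dt_late l r T) u) / 2 \<le> gate_avg l r (scost c T) u"
proof -
  define w1 where "w1 = u(l := sneg (u l), r := One)"
  define w2 where "w2 = u(l := One, r := sneg (u l))"
  have w: "w1 l = sneg (u l)" "w1 r = One" "\<And>i. i \<noteq> l \<Longrightarrow> i \<noteq> r \<Longrightarrow> w1 i = u i"
    "w2 l = One" "w2 r = sneg (u l)" "\<And>i. i \<noteq> l \<Longrightarrow> i \<noteq> r \<Longrightarrow> w2 i = u i"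
    using lr by (auto simp: w1_def w2_def)
  define \<rho>11 \<rho>01 \<rho>10 where \<rho>: "\<rho>11 = [l \<mapsto> True, r \<mapsto> True]" "\<rho>01 = [l \<mapsto> False, r \<mapsto> True]"
    "\<rho>10 = [l \<mapsto> True, r \<mapsto> False]"
  have early: "dt_early l r (Query i T0 T1) =
     (if i = l \<or> i = r then Query l (dt_restrict \<rho>11 T1) (dt_restrict (if i = l then \<rho>01 else \<rho>10) T0)
      else Query i (dt_early l r T0) (dt_early l r T1))" for i T0 T1
    by (simp only: dt_early.simps \<rho>)
  have c'l: "c' l = parent_cost (c r)" and off: "\<forall>i. i \<noteq> l \<longrightarrow> i \<noteq> r \<longrightarrow> c' i = c i"
    and off': "\<forall>i. i \<noteq> r \<longrightarrow> i \<noteq> l \<longrightarrow> c' i = c i"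
    by (auto simp: c'_def)
  note restr = restrict_pair_le[OF lr nonneg eq refl c'l off]
  have restr01: "scost c' (dt_restrict \<rho>01 T) u \<le> scost c T w1" if "u l = One" for T
    using restr[of False True T u] by (simp only: w1_def \<rho> that if_True if_False sneg.simps)
  have restr10: "scost c' (dt_restrict \<rho>10 T) u \<le> scost c T w2" if "u l = One" for T
    using restr[of True False T u] by (simp only: w2_def \<rho> that if_True if_False sneg.simps)
  have zero_eq: "w2 = w1" if "u l = Zero"
    by (simp only: w1_def w2_def that sneg.simps)
  have pend_Zero: "scost c' (dt_restrict \<rho>11 T) u + scost c' (dt_pending l l r T) u \<le> 2 * scost c T w1"
    if "u l = Zero" for T
    using pending_Zero_le[OF lr nonneg eq refl c'l off, of u T] that
    by (simp only: w1_def \<rho> that sneg.simps simp_thms)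
  have pend: "scost c' (dt_pending l l r T) u \<le> scost c T w2 + c r One / 2" if "u l \<noteq> Zero" for T
    using pending_le[OF lr nonneg eq refl c'l off, of u T] that
    by (simp only: w2_def simp_thms)
  \<comment> \<open>If \<open>r\<close> is read first, the children exchange roles while the gate
    stays at index \<open>l\<close>.\<close>
  have pend_Zero': "scost c' (dt_restrict \<rho>11 T) u + scost c' (dt_pending l r l T) u \<le> 2 * scost c T w1"
    if "u l = Zero" for T
    using pending_Zero_le[OF lr[symmetric] nonneg refl eq c'l off', of u T] that
    by (simp only: w1_def \<rho> that sneg.simps simp_thms fun_upd_twist[OF lr])
  have pend': "scost c' (dt_pending l r l T) u \<le> scost c T w1 + c r One / 2" if "u l \<noteq> Zero" for T
    using pending_le[OF lr[symmetric] nonneg refl eq c'l off', of u T] that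
    by (simp only: w1_def simp_thms fun_upd_twist[OF lr])
  have "scost c' (dt_early l r T) u + scost c' (dt_late l r T) u \<le> scost c T w1 + scost c T w2"
  proof (induction T)
    case (Query i T0 T1)
    consider "i = l" | "i = r" | "i \<noteq> l" "i \<noteq> r" by blast
    then show ?case
    proof cases
      case 1
      then show ?thesis
        using w c'l eq pend_Zero[of T1] zero_eq pend[of T1] restr01[of T0]
        by (cases "u l") (simp_all add: early del: dt_early.simps(2))
    next
      case 2
      then show ?thesis
        using lr w c'l eq pend_Zero'[of T1] zero_eq pend'[of T1] restr10[of T0]
        by (cases "u l") (simp_all add: early del: dt_early.simps(2))
    next
      case 3
      then show ?thesis
        using Query w(3,6) off by (cases "u i") (simp_all add: early del: dt_early.simps(2))
    qed
  qed simp
  then show ?thesis by (simp add: gate_avg_def w1_def w2_def)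
qed

section \<open>Contraction of the whole tree\<close>

text \<open>
  The functions bounded below by the expected cost of a randomized tree (with dyadic weights).
\<close>

inductive cost_hull :: "(nat \<Rightarrow> sval \<Rightarrow> real) \<Rightarrow> ((nat \<Rightarrow> sval) \<Rightarrow> real) \<Rightarrow> bool"
  for c where
  tree: "cost_hull c (scost c T)"
| avg: "cost_hull c G \<Longrightarrow> cost_hull c H \<Longrightarrow> cost_hull c (\<lambda>u. (G u + H u) / 2)"
| mono: "cost_hull c G \<Longrightarrow> (\<And>u. G u \<le> H u) \<Longrightarrow> cost_hull c H"

text \<open>\<open>gate_avg\<close> is linear and monotone, so only a single tree needs the
  simulation.\<close>

lemma cost_hull_gate_avg:
  assumes "l \<noteq> r" "nonneg_cost c" "c l = c r" "cost_hull c G"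
  shows "cost_hull (c(l := parent_cost (c r))) (gate_avg l r G)"
  using assms(4)
proof induction
  case (tree T)
  show ?case
    by (rule cost_hull.mono[OF cost_hull.avg[OF cost_hull.tree cost_hull.tree]])
       (rule early_late_le[OF assms(1-3)])
next
  case (avg G H)
  have "gate_avg l r (\<lambda>u. (G u + H u) / 2) = (\<lambda>u. (gate_avg l r G u + gate_avg l r H u) / 2)"
    by (auto simp: gate_avg_def fun_eq_iff field_simps)
  then show ?case using cost_hull.avg[OF avg.IH] by simp
next
  case (mono G H)
  show ?case
    by (rule cost_hull.mono[OF mono.IH])
       (use mono.hyps(2) in \<open>auto simp: gate_avg_def intro!: divide_right_mono add_mono\<close>)
qed

text \<open>
  \<open>expand d j G u\<close> is the expectation of \<open>G\<close> when the block of \<open>2^d\<close> leaves starting at \<open>j\<close> is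
  generated at random from the value \<open>u j\<close> of the root of the block.
\<close>

fun expand :: "nat \<Rightarrow> nat \<Rightarrow> ((nat \<Rightarrow> sval) \<Rightarrow> real) \<Rightarrow> (nat \<Rightarrow> sval) \<Rightarrow> real" where
  "expand 0 j G = G"
| "expand (Suc d) j G = gate_avg j (j + 2 ^ d) (expand d j (expand d (j + 2 ^ d) G))"

text \<open>The right half is contracted first, then the left half, then the gate joining them.
  Uniform leaf costs give both halves the same root cost, and unchanged costs outside a block let
  the contractions be chained.\<close>

lemma cost_hull_expand:
  assumes "nonneg_cost c" "\<And>i. i \<in> {j..<j + 2 ^ d} \<Longrightarrow> c i = k" "cost_hull c G"
  shows "\<exists>c'. nonneg_cost c' \<and> c' j = (parent_cost ^^ d) k \<and>
    (\<forall>i. i \<notin> {j..<j + 2 ^ d} \<longrightarrow> c' i = c i) \<and> cost_hull c' (expand d j G)"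
  using assms
proof (induction d arbitrary: c j G)
  case 0
  then show ?case by (intro exI[of _ c]) auto
next
  case (Suc d)
  let ?r = "j + 2 ^ d"
  obtain c1 where c1: "nonneg_cost c1" "c1 ?r = (parent_cost ^^ d) k"
    "\<And>i. i \<notin> {?r..<?r + 2 ^ d} \<Longrightarrow> c1 i = c i" "cost_hull c1 (expand d ?r G)"
    using Suc.IH[of c ?r G] Suc.prems by auto
  have "c1 i = k" if "i \<in> {j..<j + 2 ^ d}" for i
    using c1(3)[of i] Suc.prems(2)[of i] that by auto
  then obtain c2 where c2: "nonneg_cost c2" "c2 j = (parent_cost ^^ d) k"
    "\<And>i. i \<notin> {j..<j + 2 ^ d} \<Longrightarrow> c2 i = c1 i" "cost_hull c2 (expand d j (expand d ?r G))"
    using Suc.IH[of c1 j "expand d ?r G"] c1 by auto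
  have r: "c2 ?r = (parent_cost ^^ d) k" using c2(3)[of ?r] c1(2) by auto
  let ?c3 = "c2(j := parent_cost (c2 ?r))"
  have "cost_hull ?c3 (expand (Suc d) j G)"
    unfolding expand.simps by (rule cost_hull_gate_avg[OF _ c2(1) _ c2(4)]) (simp_all add: c2(2) r)
  moreover have "nonneg_cost ?c3"
    using c2(1) by (auto simp: nonneg_cost_def)
  moreover have "\<forall>i. i \<notin> {j..<j + 2 ^ Suc d} \<longrightarrow> ?c3 i = c i"
  proof (intro allI impI)
    fix i assume "i \<notin> {j..<j + 2 ^ Suc d}"
    then have "i \<noteq> j" "i \<notin> {j..<j + 2 ^ d}" "i \<notin> {?r..<?r + 2 ^ d}" by auto
    then show "?c3 i = c i" using c1(3) c2(3) by simp
  qed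
  moreover have "?c3 j = (parent_cost ^^ Suc d) k" using r by simp
  ultimately show ?case by blast
qed

section \<open>Positivity and averaging\<close>

lemma scost_nonneg:
  assumes "nonneg_cost c" "\<And>i. u i = Star \<Longrightarrow> 0 \<le> c i Star"
  shows "0 \<le> scost c T u"
proof (induction T)
  case (Query i T0 T1)
  then show ?case using assms(2)[of i] nonneg_costD[OF assms(1), of i] by (cases "u i") auto
qed simp

lemma cost_hull_nonneg:
  assumes "cost_hull c G" "nonneg_cost c" "\<And>i. u i = Star \<Longrightarrow> 0 \<le> c i Star"
  shows "0 \<le> G u"
  using assms(1)
proof induction
  case (tree T)
  then show ?case using scost_nonneg assms(2,3) by blast
next
  case (mono G H)
  then show ?case by (meson order_trans)
qed auto

lemma expand_mono:
  assumes "\<And>w. G w \<le> H w"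
  shows "expand d j G u \<le> expand d j H u"
  using assms
proof (induction d arbitrary: j G H u)
  case (Suc d)
  show ?case
    by (auto simp: gate_avg_def intro!: divide_right_mono add_mono Suc)
qed auto

lemma expand_affine: "expand d j (\<lambda>w. a + b * G w) = (\<lambda>u. a + b * expand d j G u)"
proof (induction d arbitrary: j G)
  case (Suc d)
  show ?case by (simp add: Suc.IH gate_avg_def fun_eq_iff field_simps)
qed simp

lemma expand_bounds:
  assumes "\<And>w. G w \<in> {0..1}"
  shows "expand d j G u \<in> {0..1}"
  \<comment> \<open>The constants 0 and 1 are written in the form of \<open>expand_affine\<close>,
    which shows that \<open>expand\<close> fixes them.\<close>
  using expand_mono[of "\<lambda>_. 0 + 0 * 0" G d j u] expand_mono[of G "\<lambda>_. 1 + 0 * 0" d j u] assms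
  unfolding expand_affine by auto

lemma integrable_expand:
  assumes "\<And>T w. G T w \<in> {0..1}"
  shows "integrable (measure_pmf R) (\<lambda>T. expand d j (G T) u)"
proof (rule measure_pmf.integrable_const_bound[where B=1])
  have "expand d j (G T) u \<in> {0..1}" for T
    by (rule expand_bounds) (rule assms)
  then show "AE T in measure_pmf R. norm (expand d j (G T) u) \<le> 1"
    by (intro AE_pmfI) auto
qed simp

text \<open>Exchanges the randomness of the input with that of the decision tree.\<close>

lemma expand_expectation:
  assumes "\<And>T w. G T w \<in> {0..1}"
  shows "expand d j (\<lambda>w. measure_pmf.expectation R (\<lambda>T. G T w)) u
    = measure_pmf.expectation R (\<lambda>T. expand d j (G T) u)"
  using assms
proof (induction d arbitrary: j G u)
  case (Suc d)
  let ?r = "j + 2 ^ d"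
  have "expand d ?r (\<lambda>w. measure_pmf.expectation R (\<lambda>T. G T w))
      = (\<lambda>u. measure_pmf.expectation R (\<lambda>T. expand d ?r (G T) u))"
    using Suc by auto
  moreover have "expand d j \<dots> u = measure_pmf.expectation R (\<lambda>T. expand d j (expand d ?r (G T)) u)" for u
    by (rule Suc.IH) (intro expand_bounds Suc.prems)
  moreover have "integrable (measure_pmf R) (\<lambda>T. expand d j (expand d ?r (G T)) u)" for u
    by (rule integrable_expand) (intro expand_bounds Suc.prems)
  ultimately show ?case by (simp add: gate_avg_def)
qed simp

section \<open>From ternary to Boolean inputs\<close>

definition fill :: "bool \<Rightarrow> (nat \<Rightarrow> sval) \<Rightarrow> nat \<Rightarrow> bool" where
  "fill b w i = (case w i of Zero \<Rightarrow> False | One \<Rightarrow> True | Star \<Rightarrow> b)"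

text \<open>The sibling of a star node is 1, so each level negates the value put in for the star;
  hence the parity of the height.\<close>

definition node_value :: "nat \<Rightarrow> bool \<Rightarrow> sval \<Rightarrow> bool" where
  "node_value d b v = (case v of Zero \<Rightarrow> False | One \<Rightarrow> True | Star \<Rightarrow> b = even d)"

lemma nand_tree_cong:
  assumes "\<And>i. i < 2 ^ d \<Longrightarrow> x i = y i"
  shows "nand_tree d x = nand_tree d y"
  using assms
proof (induction d arbitrary: x y)
  case (Suc d)
  have "nand_tree d x = nand_tree d y"
    using Suc.prems by (intro Suc.IH) auto
  moreover have "nand_tree d (\<lambda>i. x (2 ^ d + i)) = nand_tree d (\<lambda>i. y (2 ^ d + i))"
    using Suc.prems by (intro Suc.IH) auto
  ultimately show ?case by simp
qed simp

text \<open>An average is at least any bound valid for all outcomes; the premises on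
  \<open>w\<close> hold for every input that the random generation can produce.\<close>

lemma expand_ge:
  assumes "\<And>w. (\<And>i. i \<notin> {j..<j + 2 ^ d} \<Longrightarrow> w i = u i) \<Longrightarrow>
    (\<And>b. nand_tree d (\<lambda>i. fill b w (j + i)) = node_value d b (u j)) \<Longrightarrow> m \<le> G w"
  shows "m \<le> expand d j G u"
  using assms
proof (induction d arbitrary: j G u)
  case 0
  show ?case
    by simp (rule 0, auto simp: fill_def node_value_def split: sval.splits)
next
  case (Suc d)
  let ?r = "j + 2 ^ d"
  \<comment> \<open>Here \<open>u'\<close> stands for either order of the two children.\<close>
  have main: "m \<le> expand d j (expand d ?r G) u'"
    if u': "\<And>i. i \<noteq> j \<Longrightarrow> i \<noteq> ?r \<Longrightarrow> u' i = u i"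
      "\<And>b. (\<not> (node_value d b (u' j) \<and> node_value d b (u' ?r))) = node_value (Suc d) b (u j)" for u'
  proof (rule Suc.IH)
    fix w1 assume w1: "\<And>i. i \<notin> {j..<j + 2 ^ d} \<Longrightarrow> w1 i = u' i"
      "\<And>b. nand_tree d (\<lambda>i. fill b w1 (j + i)) = node_value d b (u' j)"
    show "m \<le> expand d ?r G w1"
    proof (rule Suc.IH)
      fix w assume w: "\<And>i. i \<notin> {?r..<?r + 2 ^ d} \<Longrightarrow> w i = w1 i"
        "\<And>b. nand_tree d (\<lambda>i. fill b w (?r + i)) = node_value d b (w1 ?r)"
      show "m \<le> G w"
      proof (rule Suc.prems)
        fix i assume i: "i \<notin> {j..<j + 2 ^ Suc d}"
        then have "i \<notin> {j..<j + 2 ^ d}" "i \<notin> {?r..<?r + 2 ^ d}" "i \<noteq> j" "i \<noteq> ?r" by auto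
        then show "w i = u i" using w(1) w1(1) u'(1) by metis
      next
        fix b
        have "nand_tree d (\<lambda>i. fill b w (j + i)) = nand_tree d (\<lambda>i. fill b w1 (j + i))"
          by (rule nand_tree_cong) (auto simp: fill_def w(1))
        moreover have "w1 ?r = u' ?r" by (rule w1(1)) auto
        ultimately show "nand_tree (Suc d) (\<lambda>i. fill b w (j + i)) = node_value (Suc d) b (u j)"
          using w(2)[of b] w1(2)[of b] u'(2)[of b] by (simp add: add.assoc)
      qed
    qed
  qed
  have "m \<le> expand d j (expand d ?r G) (u(j := sneg (u j), ?r := One))"
    by (rule main, simp) (cases "u j"; auto simp: node_value_def)
  moreover have "m \<le> expand d j (expand d ?r G) (u(j := One, ?r := sneg (u j)))"
    by (rule main, simp) (cases "u j"; auto simp: node_value_def)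
  ultimately show ?case by (simp add: gate_avg_def)
qed

lemma fill_neqD: "fill a w i \<noteq> fill b w i \<Longrightarrow> w i = Star"
  by (cases "w i") (auto simp: fill_def)

definition finds_star :: "bool \<Rightarrow> (nat \<Rightarrow> sval) \<Rightarrow> dtree \<Rightarrow> bool" where
  "finds_star b w T \<longleftrightarrow> (\<exists>i\<in>dt_queried T (fill b w). w i = Star)"

section \<open>Growth of the costs and the lower bound on \<open>RS\<close>\<close>

lemma scost_unit_le:
  assumes "0 \<le> K"
  shows "scost (\<lambda>_ v. if v = Star then 1 - K else 1) T w
    \<le> real (dt_depth T) - K * of_bool (finds_star b w T)"
proof (induction T)
  case (Query i T0 T1)
  then show ?case using assms
    by (cases "w i") (auto simp: finds_star_def fill_def)
qed (simp add: finds_star_def)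

text \<open>\<open>parent_cost\<close> multiplies the vector (1, 5/6, 5/8) by at least 5/3 in each
  coordinate: exactly for \<open>Zero\<close> and \<open>Star\<close>, with slack for
  \<open>One\<close> because 1 + 5/12 exceeds 25/18.\<close>

lemma parent_cost_iter_growth:
  "(5 / 3) ^ d \<le> (parent_cost ^^ d) (\<lambda>_. 1) Zero \<and>
   5 / 6 * (5 / 3) ^ d \<le> (parent_cost ^^ d) (\<lambda>_. 1) One \<and>
   5 / 8 * (5 / 3) ^ d \<le> (parent_cost ^^ d) (\<lambda>_. 1) Star"
proof (induction d)
  case (Suc d)
  define z where "z = (5 / 3 :: real) ^ d"
  have "0 \<le> z" by (simp add: z_def)
  with Suc show ?case by (simp flip: z_def)
qed simp

text \<open>The star cost enters only the star cost of the parent, with coefficient 1, so a discount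
  at the leaves reaches the root unchanged.\<close>

lemma parent_cost_iter_shift:
  "(parent_cost ^^ d) (\<lambda>v. if v = Star then k v - K else k v)
     = (\<lambda>v. if v = Star then (parent_cost ^^ d) k v - K else (parent_cost ^^ d) k v)"
proof (induction d)
  case 0
  show ?case by (auto simp: fun_eq_iff)
next
  case (Suc d)
  show ?case
  proof
    fix v show "(parent_cost ^^ Suc d) (\<lambda>v. if v = Star then k v - K else k v) v
      = (if v = Star then (parent_cost ^^ Suc d) k v - K else (parent_cost ^^ Suc d) k v)"
      by (cases v) (auto simp: Suc.IH)
  qed
qed

lemma expand_finds_star_le:
  assumes K: "K = (parent_cost ^^ d) (\<lambda>_. 1) Star"
    and u: "\<And>i. u i = Star \<longleftrightarrow> i = 0"
  shows "K * expand d 0 (\<lambda>w. of_bool (finds_star b w T)) u \<le> real (dt_depth T)"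
proof -
  let ?k = "\<lambda>v. if v = Star then 1 - K else 1"
  have K0: "0 \<le> K"
    using parent_cost_iter_growth[of d] zero_le_power[of "5/3::real" d] unfolding K by linarith
  obtain c where c: "nonneg_cost c" "c 0 = (parent_cost ^^ d) ?k"
    "cost_hull c (expand d 0 (scost (\<lambda>_. ?k) T))"
    using cost_hull_expand[of "\<lambda>_. ?k" 0 d ?k "scost (\<lambda>_. ?k) T"]
    by (auto simp: nonneg_cost_def intro: cost_hull.tree)
  have "c 0 Star = 0"
    using parent_cost_iter_shift[of d "\<lambda>_. 1" K] by (simp add: c(2) K)
  then have "0 \<le> expand d 0 (scost (\<lambda>_. ?k) T) u"
    using u by (intro cost_hull_nonneg[OF c(3,1)]) auto
  also have "\<dots> \<le> expand d 0 (\<lambda>w. real (dt_depth T) + (- K) * of_bool (finds_star b w T)) u"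
    using scost_unit_le[OF K0] by (intro expand_mono) auto
  finally show ?thesis unfolding expand_affine by simp
qed

text \<open>The factor 5/12 is the success probability 2/3 times the constant 5/8 for stars.\<close>

lemma RS_nand_tree_ge: "5 / 12 * (5 / 3) ^ d \<le> real (RS (2 ^ d) (nand_tree d))"
proof -
  let ?n = "2 ^ d :: nat"
  obtain R where R: "\<And>T. T \<in> set_pmf R \<Longrightarrow> dt_depth T \<le> RS ?n (nand_tree d)"
    "\<And>x y. x \<in> cube ?n \<Longrightarrow> y \<in> cube ?n \<Longrightarrow> \<not> nand_tree d x \<Longrightarrow> nand_tree d y \<Longrightarrow>
       measure_pmf.prob R {T. \<exists>i\<in>dt_queried T x. x i \<noteq> y i} \<ge> 2 / 3"
    using RS_attained[of ?n "nand_tree d"] by blast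
  define K where "K = (parent_cost ^^ d) (\<lambda>_. 1) Star"
  define u where "u = (\<lambda>i::nat. if i = 0 then Star else Zero)"
  define G where "G = (\<lambda>T w. of_bool (finds_star (odd d) w T) :: real)"
  have "2 / 3 \<le> expand d 0 (\<lambda>w. measure_pmf.expectation R (\<lambda>T. G T w)) u"
  proof (rule expand_ge)
    fix w assume w: "\<And>i. i \<notin> {0..<0 + 2 ^ d} \<Longrightarrow> w i = u i"
      "\<And>b. nand_tree d (\<lambda>i. fill b w (0 + i)) = node_value d b (u 0)"
    have "fill b w \<in> cube ?n" for b
      using w(1) by (auto simp: cube_def fill_def u_def)
    \<comment> \<open>By parity, filling the star with \<open>odd d\<close> gives a 0-input and with
      \<open>even d\<close> a 1-input; they differ only at stars.\<close>
    then have "2 / 3 \<le> measure_pmf.prob R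
        {T. \<exists>i\<in>dt_queried T (fill (odd d) w). fill (odd d) w i \<noteq> fill (even d) w i}"
      using w(2)[of "odd d"] w(2)[of "even d"] by (intro R(2)) (auto simp: node_value_def u_def)
    also have "\<dots> \<le> measure_pmf.prob R {T. finds_star (odd d) w T}"
      using fill_neqD unfolding finds_star_def
      by (intro measure_pmf.finite_measure_mono) (blast, simp)
    also have "\<dots> = measure_pmf.expectation R (indicator {T. finds_star (odd d) w T})"
      by simp
    also have "indicator {T. finds_star (odd d) w T} = (\<lambda>T. G T w)"
      by (auto simp: G_def fun_eq_iff indicator_def)
    finally show "2 / 3 \<le> measure_pmf.expectation R (\<lambda>T. G T w)" .
  qed
  also have "\<dots> = measure_pmf.expectation R (\<lambda>T. expand d 0 (G T) u)"
    by (rule expand_expectation) (simp add: G_def)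
  finally have ge: "2 / 3 \<le> measure_pmf.expectation R (\<lambda>T. expand d 0 (G T) u)" .
  have K: "5 / 8 * (5 / 3) ^ d \<le> K"
    using parent_cost_iter_growth[of d] by (simp add: K_def)
  have Kpos: "0 < K"
    using K by (rule less_le_trans[rotated]) simp
  note ge
  also have "measure_pmf.expectation R (\<lambda>T. expand d 0 (G T) u)
      \<le> measure_pmf.expectation R (\<lambda>T. real (RS ?n (nand_tree d)) / K)"
  proof (rule integral_mono_AE)
    show "integrable (measure_pmf R) (\<lambda>T. expand d 0 (G T) u)"
      by (rule integrable_expand) (simp add: G_def)
    show "AE T in measure_pmf R. expand d 0 (G T) u \<le> real (RS ?n (nand_tree d)) / K"
    proof (rule AE_pmfI)
      fix T assume "T \<in> set_pmf R"
      then have "real (dt_depth T) \<le> real (RS ?n (nand_tree d))" using R(1) by simp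
      moreover have "K * expand d 0 (G T) u \<le> real (dt_depth T)"
        unfolding G_def by (rule expand_finds_star_le) (auto simp: K_def u_def)
      ultimately show "expand d 0 (G T) u \<le> real (RS ?n (nand_tree d)) / K"
        using Kpos by (simp add: pos_le_divide_eq mult.commute)
    qed
  qed simp
  also have "\<dots> = real (RS ?n (nand_tree d)) / K" by simp
  finally have "2 / 3 * K \<le> real (RS ?n (nand_tree d))"
    using Kpos by (simp only: pos_le_divide_eq)
  with K show ?thesis by linarith
qed

section \<open>Product distributions\<close>

lemma expectation_pair_pmf_mult:
  fixes f :: "'a \<Rightarrow> real" and g :: "'b \<Rightarrow> real"
  assumes "finite (set_pmf p)" "finite (set_pmf q)"
  shows "measure_pmf.expectation (pair_pmf p q) (\<lambda>z. f (fst z) * g (snd z))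
    = measure_pmf.expectation p f * measure_pmf.expectation q g"
proof -
  have "measure_pmf.expectation (pair_pmf p q) (\<lambda>z. f (fst z) * g (snd z))
      = (\<Sum>z\<in>set_pmf p \<times> set_pmf q. pmf (pair_pmf p q) z * (f (fst z) * g (snd z)))"
    using assms by (subst integral_measure_pmf[of "set_pmf p \<times> set_pmf q"]) auto
  also have "\<dots> = (\<Sum>a\<in>set_pmf p. \<Sum>b\<in>set_pmf q. (pmf p a * f a) * (pmf q b * g b))"
    by (subst sum.cartesian_product) (auto intro!: sum.cong simp: pmf_pair)
  also have "\<dots> = (\<Sum>a\<in>set_pmf p. pmf p a * f a) * (\<Sum>b\<in>set_pmf q. pmf q b * g b)"
    by (simp add: sum_product)
  also have "\<dots> = measure_pmf.expectation p f * measure_pmf.expectation q g"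
    using assms by (simp add: integral_measure_pmf[of "set_pmf p"] integral_measure_pmf[of "set_pmf q"])
  finally show ?thesis .
qed

lemma finite_set_Pi_pmf:
  fixes q :: "'a \<Rightarrow> 'b :: finite pmf"
  assumes "finite A"
  shows "finite (set_pmf (Pi_pmf A dflt q))"
  by (rule finite_subset[OF set_Pi_pmf_subset'[OF assms]])
     (auto intro: assms)

lemma integrable_Pi_pmf [simp]:
  fixes q :: "'a \<Rightarrow> 'b :: finite pmf" and f :: "('a \<Rightarrow> 'b) \<Rightarrow> real"
  assumes "finite A"
  shows "integrable (measure_pmf (Pi_pmf A dflt q)) f"
  by (rule integrable_measure_pmf_finite[OF finite_set_Pi_pmf[OF assms]])

definition depends_on :: "'a set \<Rightarrow> (('a \<Rightarrow> 'b) \<Rightarrow> 'c) \<Rightarrow> bool" where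
  "depends_on B f \<longleftrightarrow> (\<forall>x y. (\<forall>i\<in>B. x i = y i) \<longrightarrow> f x = f y)"

text \<open>Coordinates in \<open>B\<close> and in \<open>A - B\<close> are sampled separately;
  \<open>f\<close> sees only the first sample and \<open>g\<close> only the second.\<close>

lemma expectation_Pi_pmf_mult:
  fixes q :: "'a \<Rightarrow> 'b :: finite pmf" and f g :: "('a \<Rightarrow> 'b) \<Rightarrow> real"
  assumes A: "finite A" "B \<subseteq> A" and BC: "B \<inter> C = {}"
    and f: "depends_on B f" and g: "depends_on C g"
  shows "measure_pmf.expectation (Pi_pmf A dflt q) (\<lambda>x. f x * g x)
    = measure_pmf.expectation (Pi_pmf A dflt q) f * measure_pmf.expectation (Pi_pmf A dflt q) g"
proof -
  let ?h = "\<lambda>z i. if i \<in> B then fst z i else snd z i"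
  let ?P = "Pi_pmf B dflt q" and ?Q = "Pi_pmf (A - B) dflt q"
  have fin: "finite B" using A finite_subset by blast
  have "Pi_pmf (B \<union> (A - B)) dflt q = map_pmf ?h (pair_pmf ?P ?Q)"
    using A fin by (subst Pi_pmf_union) (auto simp: case_prod_unfold)
  moreover have "B \<union> (A - B) = A" using A by blast
  ultimately have eq: "Pi_pmf A dflt q = map_pmf ?h (pair_pmf ?P ?Q)" by simp
  have "f (?h z) = f (fst z)" for z
    using f[unfolded depends_on_def, rule_format, of "?h z" "fst z"] by simp
  moreover have "g (?h z) = g (snd z)" for z
    by (rule g[unfolded depends_on_def, rule_format]) (use BC in auto)
  ultimately show ?thesis
    using A fin by (simp add: eq expectation_pair_pmf_mult finite_set_Pi_pmf)
qed

section \<open>Composing and truncating decision trees\<close>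

fun dt_length :: "dtree \<Rightarrow> (nat \<Rightarrow> bool) \<Rightarrow> nat" where
  "dt_length (Leaf b) x = 0"
| "dt_length (Query i T0 T1) x = Suc (if x i then dt_length T1 x else dt_length T0 x)"

text \<open>The second tree is grafted only at the 1-leaves of the first, since a 0 already decides
  the gate.\<close>

fun dt_nand :: "dtree \<Rightarrow> dtree \<Rightarrow> dtree" where
  "dt_nand (Leaf True) (Leaf b) = Leaf (\<not> b)"
| "dt_nand (Leaf True) (Query i S0 S1) = Query i (dt_nand (Leaf True) S0) (dt_nand (Leaf True) S1)"
| "dt_nand (Leaf False) S = Leaf True"
| "dt_nand (Query i T0 T1) S = Query i (dt_nand T0 S) (dt_nand T1 S)"

lemma dt_nand_indices: "dt_indices (dt_nand T S) \<subseteq> dt_indices T \<union> dt_indices S"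
  by (induction T S rule: dt_nand.induct) auto

lemma dt_nand_eval: "dt_eval (dt_nand T S) x = (\<not> (dt_eval T x \<and> dt_eval S x))"
  by (induction T S rule: dt_nand.induct) auto

lemma dt_nand_length:
  "dt_length (dt_nand T S) x = dt_length T x + (if dt_eval T x then dt_length S x else 0)"
  by (induction T S rule: dt_nand.induct) auto

lemma depends_on_dt_eval: "dt_indices T \<subseteq> B \<Longrightarrow> depends_on B (\<lambda>x. h (dt_eval T x))"
  unfolding depends_on_def
proof (intro allI impI)
  fix x y :: "nat \<Rightarrow> bool" assume "dt_indices T \<subseteq> B" "\<forall>i\<in>B. x i = y i"
  then have "dt_eval T x = dt_eval T y" by (induction T) auto
  then show "h (dt_eval T x) = h (dt_eval T y)" by simp
qed

lemma depends_on_dt_length: "dt_indices T \<subseteq> B \<Longrightarrow> depends_on B (\<lambda>x. h (dt_length T x))"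
  unfolding depends_on_def
proof (intro allI impI)
  fix x y :: "nat \<Rightarrow> bool" assume "dt_indices T \<subseteq> B" "\<forall>i\<in>B. x i = y i"
  then have "dt_length T x = dt_length T y" by (induction T) auto
  then show "h (dt_length T x) = h (dt_length T y)" by simp
qed

text \<open>The answer \<open>False\<close> on exhausted budget is arbitrary: every run cut short
  will be counted as an error.\<close>

fun dt_truncate :: "nat \<Rightarrow> dtree \<Rightarrow> dtree" where
  "dt_truncate t (Leaf b) = Leaf b"
| "dt_truncate 0 (Query i T0 T1) = Leaf False"
| "dt_truncate (Suc t) (Query i T0 T1) = Query i (dt_truncate t T0) (dt_truncate t T1)"

lemma dt_truncate_indices: "dt_indices (dt_truncate t T) \<subseteq> dt_indices T"
  by (induction t T rule: dt_truncate.induct) auto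

lemma dt_truncate_depth: "dt_depth (dt_truncate t T) \<le> t"
  by (induction t T rule: dt_truncate.induct) auto

lemma dt_truncate_eval: "dt_length T x \<le> t \<Longrightarrow> dt_eval (dt_truncate t T) x = dt_eval T x"
  by (induction t T rule: dt_truncate.induct) (auto split: if_splits)

section \<open>Expected cost and the upper bound on \<open>D_prod\<close>\<close>

text \<open>The worst case is \<open>q = p\<close>. There the claim is that p - 105/128 p^2 stays
  below 5/16, and its maximum, at p = 64/105, is 32/105.\<close>

lemma gate_cost_le:
  fixes p q :: real
  assumes "0 \<le> p" "p \<le> q" "q \<le> 1"
  shows "(1 + 5 / 16 * (1 - p)) + p * (1 + 5 / 16 * (1 - q)) \<le> 13 / 8 * (1 + 5 / 16 * (p * q))"
proof -
  have "p * p \<le> p * q" using assms by (intro mult_left_mono) auto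
  moreover have "0 \<le> 105 / 128 * (p - 64 / 105)\<^sup>2" by simp
  moreover have "105 / 128 * (p - 64 / 105)\<^sup>2 = 105 / 128 * (p * p) - p + 32 / 105"
    by (simp add: power2_eq_square algebra_simps)
  ultimately have "21 / 16 + p - 5 / 16 * (p * q) \<le> 13 / 8 + 65 / 128 * (p * q)"
    by linarith
  also have "21 / 16 + p - 5 / 16 * (p * q) = (1 + 5 / 16 * (1 - p)) + p * (1 + 5 / 16 * (1 - q))"
    by algebra
  also have "13 / 8 + 65 / 128 * (p * q) = 13 / 8 * (1 + 5 / 16 * (p * q))"
    by algebra
  finally show ?thesis .
qed

text \<open>The index set \<open>A\<close> may exceed the block, so that both halves are analysed
  under the same distribution.\<close>

lemma nand_tree_expected_length:
  fixes q :: "nat \<Rightarrow> bool pmf"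
  assumes A: "finite A" "{j..<j + 2 ^ d} \<subseteq> A"
  defines "\<mu> \<equiv> Pi_pmf A False q"
  shows "\<exists>T. dt_indices T \<subseteq> {j..<j + 2 ^ d} \<and>
    (\<forall>x. dt_eval T x = nand_tree d (\<lambda>i. x (j + i))) \<and>
    measure_pmf.expectation \<mu> (\<lambda>x. real (dt_length T x))
      \<le> (13 / 8) ^ d * (1 + 5 / 16 * (1 - measure_pmf.expectation \<mu> (\<lambda>x. of_bool (dt_eval T x))))"
  using A(2)
proof (induction d arbitrary: j)
  case 0
  let ?T = "Query j (Leaf False) (Leaf True)"
  have "measure_pmf.expectation \<mu> (\<lambda>x. of_bool (dt_eval ?T x) :: real)
      \<le> measure_pmf.expectation \<mu> (\<lambda>_. 1)"
    unfolding \<mu>_def using A(1) by (intro integral_mono) auto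
  moreover have "dt_length ?T = (\<lambda>_. 1)" by (simp add: fun_eq_iff)
  ultimately have "measure_pmf.expectation \<mu> (\<lambda>x. real (dt_length ?T x))
      \<le> (13 / 8) ^ 0 * (1 + 5 / 16 * (1 - measure_pmf.expectation \<mu> (\<lambda>x. of_bool (dt_eval ?T x))))"
    by (simp del: dt_length.simps dt_eval.simps)
  then show ?case by (intro exI[of _ ?T]) auto
next
  case (Suc d)
  let ?r = "j + 2 ^ d"
  let ?E = "\<lambda>f. measure_pmf.expectation \<mu> f"
  define val :: "dtree \<Rightarrow> real" where "val T = ?E (\<lambda>x. of_bool (dt_eval T x))" for T
  define len where "len T = ?E (\<lambda>x. real (dt_length T x))" for T
  have int: "integrable (measure_pmf \<mu>) f" for f :: "_ \<Rightarrow> real"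
    unfolding \<mu>_def using A(1) by simp
  have val_bounds: "0 \<le> val T" "val T \<le> 1" for T
    using integral_mono[OF int int, of "\<lambda>x. of_bool (dt_eval T x)" "\<lambda>_. 1"]
    by (auto simp: val_def intro!: Bochner_Integration.integral_nonneg)
  have sub: "{j..<j + 2 ^ d} \<subseteq> A" "{?r..<?r + 2 ^ d} \<subseteq> A"
    using Suc.prems by (auto simp: subset_iff)
  obtain L where L: "dt_indices L \<subseteq> {j..<j + 2 ^ d}"
    "\<And>x. dt_eval L x = nand_tree d (\<lambda>i. x (j + i))"
    "len L \<le> (13 / 8) ^ d * (1 + 5 / 16 * (1 - val L))"
    using Suc.IH[OF sub(1)] unfolding len_def val_def by blast
  obtain R where R: "dt_indices R \<subseteq> {?r..<?r + 2 ^ d}"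
    "\<And>x. dt_eval R x = nand_tree d (\<lambda>i. x (?r + i))"
    "len R \<le> (13 / 8) ^ d * (1 + 5 / 16 * (1 - val R))"
    using Suc.IH[OF sub(2)] unfolding len_def val_def by blast
  \<comment> \<open>Stated for an ordered pair, with the tree less likely to be 1 first; either half
    may take that place.\<close>
  have combine: "len (dt_nand S T) \<le> (13 / 8) ^ Suc d * (1 + 5 / 16 * (1 - val (dt_nand S T)))"
    if S: "dt_indices S \<subseteq> B" "B \<subseteq> A" "len S \<le> (13 / 8) ^ d * (1 + 5 / 16 * (1 - val S))"
      and T: "dt_indices T \<subseteq> C" "len T \<le> (13 / 8) ^ d * (1 + 5 / 16 * (1 - val T))"
      and BC: "B \<inter> C = {}" and le: "val S \<le> val T" for S T B C
  proof -
    have evS: "depends_on B (\<lambda>x. of_bool (dt_eval S x) :: real)"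
      and evT: "depends_on C (\<lambda>x. of_bool (dt_eval T x) :: real)"
      and lenT: "depends_on C (\<lambda>x. real (dt_length T x))"
      by (rule depends_on_dt_eval[OF S(1)] depends_on_dt_eval[OF T(1)] depends_on_dt_length[OF T(1)])+
    have "len (dt_nand S T) = ?E (\<lambda>x. real (dt_length S x) + of_bool (dt_eval S x) * real (dt_length T x))"
      unfolding len_def by (rule Bochner_Integration.integral_cong) (auto simp: dt_nand_length)
    also have "\<dots> = len S + val S * len T"
      unfolding len_def val_def \<mu>_def
      using expectation_Pi_pmf_mult[OF A(1) S(2) BC evS lenT] A(1) by simp
    finally have lenST: "len (dt_nand S T) = len S + val S * len T" .
    have "val (dt_nand S T) = ?E (\<lambda>x. 1 - of_bool (dt_eval S x) * of_bool (dt_eval T x))"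
      unfolding val_def by (rule Bochner_Integration.integral_cong) (auto simp: dt_nand_eval)
    also have "\<dots> = 1 - val S * val T"
      unfolding val_def \<mu>_def
      using expectation_Pi_pmf_mult[OF A(1) S(2) BC evS evT] A(1) by simp
    finally have valST: "val (dt_nand S T) = 1 - val S * val T" .
    have "len S + val S * len T \<le> (13 / 8) ^ d * (1 + 5 / 16 * (1 - val S))
        + val S * ((13 / 8) ^ d * (1 + 5 / 16 * (1 - val T)))"
      using S T val_bounds by (intro add_mono mult_left_mono) auto
    also have "\<dots> = (13 / 8) ^ d * ((1 + 5 / 16 * (1 - val S)) + val S * (1 + 5 / 16 * (1 - val T)))"
      by (simp add: algebra_simps)
    also have "\<dots> \<le> (13 / 8) ^ d * (13 / 8 * (1 + 5 / 16 * (val S * val T)))"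
      using val_bounds le by (intro mult_left_mono gate_cost_le) auto
    also have "\<dots> = (13 / 8) ^ Suc d * (1 + 5 / 16 * (1 - val (dt_nand S T)))"
      by (simp add: valST algebra_simps)
    finally show ?thesis unfolding lenST .
  qed
  have disj: "{j..<j + 2 ^ d} \<inter> {?r..<?r + 2 ^ d} = {}" by auto
  have *: "\<exists>T. dt_indices T \<subseteq> {j..<j + 2 ^ Suc d} \<and>
      (\<forall>x. dt_eval T x = nand_tree (Suc d) (\<lambda>i. x (j + i))) \<and>
      len T \<le> (13 / 8) ^ Suc d * (1 + 5 / 16 * (1 - val T))"
  proof (cases "val L \<le> val R")
    case True
    have "dt_indices (dt_nand L R) \<subseteq> {j..<j + 2 ^ Suc d}"
      using dt_nand_indices[of L R] L(1) R(1) by (force simp: subset_iff)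
    then show ?thesis
      using combine[OF L(1) sub(1) L(3) R(1) R(3) disj True]
      by (intro exI[of _ "dt_nand L R"]) (auto simp: dt_nand_eval L(2) R(2) add.assoc)
  next
    case False
    then have le: "val R \<le> val L" by simp
    have "dt_indices (dt_nand R L) \<subseteq> {j..<j + 2 ^ Suc d}"
      using dt_nand_indices[of R L] L(1) R(1) by (force simp: subset_iff)
    then show ?thesis
      using combine[OF R(1) sub(2) R(3) L(1) L(3) _ le] disj
      by (intro exI[of _ "dt_nand R L"]) (auto simp: dt_nand_eval L(2) R(2) add.assoc)
  qed
  then show ?case unfolding len_def val_def .
qed

lemma dist_complexity_nand_tree_le:
  assumes "\<mu> \<in> product_distributions (2 ^ d)"
  shows "real (dist_complexity (2 ^ d) (nand_tree d) \<mu>) \<le> 4 * (13 / 8) ^ d"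
proof -
  let ?n = "2 ^ d :: nat"
  obtain q where \<mu>: "\<mu> = Pi_pmf {..<?n} False q"
    using assms by (auto simp: product_distributions_def)
  have sub: "{0..<0 + 2 ^ d} \<subseteq> {..<?n}" by auto
  obtain T where T: "dt_indices T \<subseteq> {0..<0 + 2 ^ d}"
    "\<And>x. dt_eval T x = nand_tree d (\<lambda>i. x (0 + i))"
    "measure_pmf.expectation \<mu> (\<lambda>x. real (dt_length T x))
      \<le> (13 / 8) ^ d * (1 + 5 / 16 * (1 - measure_pmf.expectation \<mu> (\<lambda>x. of_bool (dt_eval T x))))"
    using nand_tree_expected_length[OF finite_lessThan sub, of q] unfolding \<mu> by blast
  define p :: real where "p = measure_pmf.expectation \<mu> (\<lambda>x. of_bool (dt_eval T x))"
  have "0 \<le> p"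
    unfolding p_def by (intro Bochner_Integration.integral_nonneg) auto
  then have "(13 / 8) ^ d * (1 + 5 / 16 * (1 - p)) \<le> (13 / 8) ^ d * (4 / 3)"
    by (intro mult_left_mono) (simp_all add: field_simps)
  then have E: "measure_pmf.expectation \<mu> (\<lambda>x. real (dt_length T x)) \<le> (13 / 8) ^ d * (4 / 3)"
    by (rule order_trans[OF T(3)[folded p_def]])
  \<comment> \<open>Since 1 + 5/16 is at most 4/3, the budget 4 = 3 * 4/3 is three times the
    expected cost. A longer run has length at least \<open>t + 1\<close>, so rounding down does not
    weaken Markov's inequality.\<close>
  define t where "t = nat \<lfloor>4 * (13 / 8 :: real) ^ d\<rfloor>"
  have "0 \<le> 4 * (13 / 8 :: real) ^ d" by simp
  then have t: "real t \<le> 4 * (13 / 8) ^ d" "4 * (13 / 8) ^ d < real t + 1"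
    unfolding t_def by linarith+
  have "measure_pmf.prob \<mu> {x. dt_eval (dt_truncate t T) x \<noteq> nand_tree d x}
      \<le> measure_pmf.prob \<mu> {x \<in> space (measure_pmf \<mu>). real t + 1 \<le> real (dt_length T x)}"
  proof (intro measure_pmf.finite_measure_mono subsetI)
    fix x assume "x \<in> {x. dt_eval (dt_truncate t T) x \<noteq> nand_tree d x}"
    then have "\<not> dt_length T x \<le> t"
      using dt_truncate_eval[of T x t] T(2)[of x] by auto
    then show "x \<in> {x \<in> space (measure_pmf \<mu>). real t + 1 \<le> real (dt_length T x)}"
      by simp
  qed simp
  also have "\<dots> \<le> measure_pmf.expectation \<mu> (\<lambda>x. real (dt_length T x)) / (real t + 1)"
    by (rule integral_Markov_inequality_measure[where A="{}"]) (auto simp: \<mu>)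
  also have "\<dots> \<le> 1 / 3"
  proof -
    have "3 * measure_pmf.expectation \<mu> (\<lambda>x. real (dt_length T x)) \<le> 4 * (13 / 8) ^ d"
      using E by simp
    also have "\<dots> \<le> real t + 1" using t by simp
    finally show ?thesis by (simp add: pos_divide_le_eq)
  qed
  finally have "dist_complexity ?n (nand_tree d) \<mu> \<le> dt_depth (dt_truncate t T)"
    unfolding dist_complexity_def using T(1) dt_truncate_indices[of t T]
    by (intro Least_le bexI[of _ "dt_truncate t T"]) (auto simp: dtrees_def subset_iff)
  also have "\<dots> \<le> t" by (rule dt_truncate_depth)
  finally show ?thesis using t(1) by simp
qed

lemma D_prod_nand_tree_le: "real (D_prod (2 ^ d) (nand_tree d)) \<le> 4 * (13 / 8) ^ d"
proof -
  have "D_prod (2 ^ d) (nand_tree d) \<in> dist_complexity (2 ^ d) (nand_tree d) ` product_distributions (2 ^ d)"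
    unfolding D_prod_def
    by (rule Max_in) (use finite_dist_complexity product_distributions_nonempty in auto)
  then show ?thesis using dist_complexity_nand_tree_le by auto
qed

section \<open>Comparing the exponential bounds\<close>

lemma bigo_powr_of_exponential_bounds:
  fixes D S :: "nat \<Rightarrow> real"
  assumes D: "\<And>d. 0 \<le> D d" "\<And>d. D d \<le> C * a ^ d" and S: "\<And>d. B * b ^ d \<le> S d"
    and ab: "1 < a" "a < b" and B: "0 < B"
  shows "\<exists>c<1. D \<in> O(\<lambda>d. S d powr c)"
proof -
  \<comment> \<open>Chosen so that \<open>b powr c = a\<close>; it is below 1 because
    \<open>a < b\<close>.\<close>
  define c where "c = ln a / ln b"
  have "0 < ln a" "ln a < ln b" using ab by auto
  then have c: "0 < c" "c < 1" by (auto simp: c_def)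
  have "norm (D d) \<le> \<bar>C\<bar> / B powr c * norm (S d powr c)" for d
  proof -
    have "b powr c = a" using ab by (simp add: c_def powr_def)
    then have "a ^ d = (b ^ d) powr c"
      using ab by (metis (no_types, opaque_lifting) less_trans powr_powr_swap powr_realpow zero_less_one)
    then have "B powr c * a ^ d = (B * b ^ d) powr c"
      using ab B by (simp add: powr_mult)
    also have "\<dots> \<le> S d powr c"
      using S[of d] ab B c by (intro powr_mono2) auto
    finally have "a ^ d \<le> S d powr c / B powr c"
      using B by (simp add: pos_le_divide_eq mult.commute)
    then have "\<bar>C\<bar> * a ^ d \<le> \<bar>C\<bar> * (S d powr c / B powr c)"
      by (intro mult_left_mono) auto
    moreover have "D d \<le> \<bar>C\<bar> * a ^ d"
    proof -
      have "C * a ^ d \<le> \<bar>C\<bar> * a ^ d"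
        using ab by (intro mult_right_mono) auto
      then show ?thesis using D(2)[of d] by linarith
    qed
    ultimately show ?thesis using D(1)[of d] by simp
  qed
  then have "D \<in> O(\<lambda>d. S d powr c)"
    by (intro bigoI[where c="\<bar>C\<bar> / B powr c"] always_eventually allI)
  with c show ?thesis by blast
qed

theorem theorem4:
  "\<exists>c<1. (\<lambda>d. real (D_prod (2 ^ d) (nand_tree d)))
      \<in> O(\<lambda>d. real (RS (2 ^ d) (nand_tree d)) powr c)"
  \<comment> \<open>The numerical condition is 13/8 < 5/3, that is, 39 < 40.\<close>
  by (rule bigo_powr_of_exponential_bounds[OF _ D_prod_nand_tree_le RS_nand_tree_ge]) simp_all

end
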